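(* Let $(\mathbf{H},\varphi)$ be a linearized combinatorial Hopf monoid, let $N$ be a finite set, $\mathbf{h}\in\mathbf{H}[N]$, and $\mathfrak{G}\subseteq\mathrm{Aut}(\mathbf{h})$. Then: \begin{enumerate} \item for every $\mathfrak{g}\in\mathfrak{G}$, $\Psi_{\mathbf{H},\varphi}(\mathbf{h},\mathfrak{G},\mathbf{x};\mathfrak{g})=\sum_{C\in\mathcal{C}_\varphi(\mathbf{h}):\ \mathfrak{g}C=C} M_{\alpha(C)}$; \item $\Psi_{\mathbf{H},\varphi}(\mathbf{h},\mathfrak{G},\mathbf{x})=\sum_{\alpha\models|N|}\Psi_{\mathbf{h},\alpha}M_\alpha$; \item $\Psi_{\mathbf{H},\varphi}(\mathbf{h},\mathfrak{G},x)=\sum_{\alpha\models|N|}\Psi_{\mathbf{h},\alpha}\binom{x}{\ell(\alpha)}$. \end{enumerate}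
   Context: $\mathbb{N}=\{0,1,2,\dots\}$, $[x]=\{1,\dots,x\}$, $\mathbf{x}=x_1,x_2,\dots$ commuting indeterminates. A set species $\mathbf{H}$ assigns to each finite set $N$ a finite set $\mathbf{H}[N]$ and to each bijection $\sigma:M\to N$ a bijection $\mathbf{H}[\sigma]:\mathbf{H}[M]\to\mathbf{H}[N]$, functorially. A linearized Hopf monoid is a set species with $|\mathbf{H}[\emptyset]|=1$ together with, for all disjoint finite $M,N$, maps $\mu_{M,N}:\mathbf{H}[M]\times\mathbf{H}[N]\to\mathbf{H}[M\sqcup N]$, $(x,y)\mapsto x\cdot y$, and $\Delta_{M,N}:\mathbf{H}[M\sqcup N]\to(\mathbf{H}[M]\times\mathbf{H}[N])\sqcup\{0\}$, writing $\Delta_{M,N}(\mathbf{h})=(\mathbf{h}|_M,\mathbf{h}/M)$ when nonzero, such that their linear extensions make the linearization (the linear species with $N\mapsto$ the vector space with basis $\mathbf{H}[N]$) a connected Hopf monoid in linear species. A linearized character is a family of maps $\varphi_N:\mathbf{H}[N]\to\{0,1\}$, natural with respect to bijections, with $\varphi(x\cdot y)=\varphi(x)\varphi(y)$; the pair $(\mathbf{H},\varphi)$ is a linearized combinatorial Hopf monoid. A set composition $C=C_1|\cdots|C_k\models N$ is a sequence of disjoint nonempty sets with union $N$; $\ell(C)=k$, type $\alpha(C)=(|C_1|,\dots,|C_k|)$. Define $\Delta_C(\mathbf{h})$ iteratively: for $k=1$ it is $\mathbf{h}$; otherwise it is $0$ if $\Delta_{C_1,N\setminus C_1}(\mathbf{h})=0$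 and else $(\mathbf{h}|_{C_1},\Delta_{C_2|\cdots|C_k}(\mathbf{h}/C_1))$. Set $\varphi_C(\mathbf{h})=\prod_i\varphi(\mathbf{h}_i)$ if $\Delta_C(\mathbf{h})=(\mathbf{h}_1,\dots,\mathbf{h}_k)$ and $\varphi_C(\mathbf{h})=0$ if it is $0$. $C$ is $\varphi$-proper if $\varphi_C(\mathbf{h})=1$; $\mathcal{C}_\varphi(\mathbf{h})$ is the set of $\varphi$-proper set compositions and $\mathcal{C}_{\mathbf{h},\alpha}$ those of type $\alpha$. For $f:N\to\mathbb{N}$ with values $i_1<\dots<i_k$, $C(f)=f^{-1}(i_1)|\cdots|f^{-1}(i_k)$, and $f$ is a $\varphi$-proper coloring of $\mathbf{h}$ iff $\varphi_{C(f)}(\mathbf{h})=1$; $F_\varphi(\mathbf{h})$ is the set of these. $\mathfrak{S}_N$ acts on $\mathbf{H}[N]$ by $\mathfrak{g}\cdot\mathbf{h}=\mathbf{H}[\mathfrak{g}](\mathbf{h})$, $\mathrm{Aut}(\mathbf{h})$ is the stabilizer of $\mathbf{h}$; $\mathfrak{g}$ acts on colorings by $\mathfrak{g}f=f\circ\mathfrak{g}^{-1}$ and on set compositions by $\mathfrak{g}C=\mathfrak{g}(C_1)|\cdots|\mathfrak{g}(C_k)$. For $\mathfrak{g}\in\mathfrak{G}$: $\Psi_{\mathbf{H},\varphi}(\mathbf{h},\mathfrak{G},\mathbf{x};\mathfrak{g})=\sum_{f\in F_\varphi(\mathbf{h}),\ \mathfrak{g}f=f}\prod_{v\in N}x_{f(v)}$,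 and $\Psi_{\mathbf{H},\varphi}(\mathbf{h},\mathfrak{G},x;\mathfrak{g})$ is the number of $f\in F_\varphi(\mathbf{h})$ with $\mathfrak{g}f=f$ and $f(N)\subseteq[x]$. $M_\alpha=\sum_{i_1<\cdots<i_k}\prod_jx_{i_j}^{\alpha_j}$ is the monomial quasisymmetric function, $\ell(\alpha)$ the number of parts of $\alpha$. $\mathfrak{G}$ acts on $\mathcal{C}_{\mathbf{h},\alpha}$, and $\Psi_{\mathbf{h},\alpha}$ denotes the resulting permutation character, $\Psi_{\mathbf{h},\alpha}(\mathfrak{g})=|\{C\in\mathcal{C}_{\mathbf{h},\alpha}:\mathfrak{g}C=C\}|$. Identities 2 and 3 are equalities of functions of $\mathfrak{g}\in\mathfrak{G}$. *)

theory Defs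
  imports
    Complex_Main
    "HOL-Library.Poly_Mapping"
    "HOL-Library.Disjoint_Sets"
    "HOL-Library.FuncSet"
    "HOL-Library.Function_Algebras"
    "HOL-Combinatorics.Permutations"
    "HOL-Algebra.Group_Action"
begin

section \<open>Free vector spaces\<close>

text \<open>
  Every vector space is taken with a basis: the space with basis \<open>X\<close> over the field \<open>'k\<close>
  consists of the finitely supported functions with support in \<open>X\<close>. The tensor product of the
  spaces with bases \<open>X\<close> and \<open>Y\<close> is the space with basis \<open>X \<times> Y\<close>.
\<close>

definition free_space :: "'b set \<Rightarrow> ('b \<Rightarrow>\<^sub>0 'k::field) set" where
  "free_space X = {v. Poly_Mapping.keys v \<subseteq> X}"

abbreviation basis_vec :: "'b \<Rightarrow> 'b \<Rightarrow>\<^sub>0 'k::field" where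
  "basis_vec b \<equiv> Poly_Mapping.single b 1"

definition smul :: "'k::field \<Rightarrow> ('b \<Rightarrow>\<^sub>0 'k) \<Rightarrow> 'b \<Rightarrow>\<^sub>0 'k" where
  "smul c v = Poly_Mapping.map ((*) c) v"

definition linear_map ::
  "'b set \<Rightarrow> 'c set \<Rightarrow> (('b \<Rightarrow>\<^sub>0 'k::field) \<Rightarrow> 'c \<Rightarrow>\<^sub>0 'k) \<Rightarrow> bool" where
  "linear_map X Y f \<longleftrightarrow>
     (\<forall>u\<in>free_space X. f u \<in> free_space Y) \<and>
     (\<forall>u\<in>free_space X. \<forall>v\<in>free_space X. f (u + v) = f u + f v) \<and>
     (\<forall>c. \<forall>u\<in>free_space X. f (smul c u) = smul c (f u))"

definition linear_form :: "'b set \<Rightarrow> (('b \<Rightarrow>\<^sub>0 'k::field) \<Rightarrow> 'k) \<Rightarrow> bool" where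
  "linear_form X e \<longleftrightarrow>
     (\<forall>u\<in>free_space X. \<forall>v\<in>free_space X. e (u + v) = e u + e v) \<and>
     (\<forall>c. \<forall>u\<in>free_space X. e (smul c u) = c * e u)"

definition lin_ext :: "('b \<Rightarrow> 'c \<Rightarrow>\<^sub>0 'k::field) \<Rightarrow> ('b \<Rightarrow>\<^sub>0 'k) \<Rightarrow> 'c \<Rightarrow>\<^sub>0 'k" where
  "lin_ext f v = (\<Sum>b\<in>Poly_Mapping.keys v. smul (Poly_Mapping.lookup v b) (f b))"

definition tensor :: "('b \<Rightarrow>\<^sub>0 'k::field) \<Rightarrow> ('c \<Rightarrow>\<^sub>0 'k) \<Rightarrow> ('b \<times> 'c) \<Rightarrow>\<^sub>0 'k" where
  "tensor u v = (\<Sum>b\<in>Poly_Mapping.keys u. \<Sum>c\<in>Poly_Mapping.keys v.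
     Poly_Mapping.single (b, c) (Poly_Mapping.lookup u b * Poly_Mapping.lookup v c))"

definition tensor_map ::
  "(('b \<Rightarrow>\<^sub>0 'k::field) \<Rightarrow> 'd \<Rightarrow>\<^sub>0 'k) \<Rightarrow> (('c \<Rightarrow>\<^sub>0 'k) \<Rightarrow> 'e \<Rightarrow>\<^sub>0 'k) \<Rightarrow>
   (('b \<times> 'c) \<Rightarrow>\<^sub>0 'k) \<Rightarrow> ('d \<times> 'e) \<Rightarrow>\<^sub>0 'k" where
  "tensor_map f g = lin_ext (\<lambda>(b, c). tensor (f (basis_vec b)) (g (basis_vec c)))"

definition tensor_assoc :: "((('b \<times> 'c) \<times> 'd) \<Rightarrow>\<^sub>0 'k::field) \<Rightarrow> ('b \<times> 'c \<times> 'd) \<Rightarrow>\<^sub>0 'k" where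
  "tensor_assoc = lin_ext (\<lambda>((b, c), d). basis_vec (b, c, d))"

definition tensor_middle_swap ::
  "((('b \<times> 'c) \<times> ('d \<times> 'e)) \<Rightarrow>\<^sub>0 'k::field) \<Rightarrow> (('b \<times> 'd) \<times> ('c \<times> 'e)) \<Rightarrow>\<^sub>0 'k" where
  "tensor_middle_swap = lin_ext (\<lambda>((b, c), (d, e)). basis_vec ((b, d), (c, e)))"

definition contract_left ::
  "(('b \<Rightarrow>\<^sub>0 'k::field) \<Rightarrow> 'k) \<Rightarrow> (('b \<times> 'c) \<Rightarrow>\<^sub>0 'k) \<Rightarrow> 'c \<Rightarrow>\<^sub>0 'k" where
  "contract_left e = lin_ext (\<lambda>(b, c). smul (e (basis_vec b)) (basis_vec c))"

definition contract_right ::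
  "(('c \<Rightarrow>\<^sub>0 'k::field) \<Rightarrow> 'k) \<Rightarrow> (('b \<times> 'c) \<Rightarrow>\<^sub>0 'k) \<Rightarrow> 'b \<Rightarrow>\<^sub>0 'k" where
  "contract_right e = lin_ext (\<lambda>(b, c). smul (e (basis_vec c)) (basis_vec b))"


section \<open>Connected Hopf monoids in linear species\<close>

text \<open>
  Species are evaluated on the finite subsets of a label type \<open>'a\<close>. A bijection \<open>\<sigma> : M \<rightarrow> N\<close> is
  given by a function on \<open>'a\<close> together with its domain \<open>M\<close>; the congruence axioms below say that
  only its values on \<open>M\<close> matter. For infinite \<open>'a\<close> this is equivalent to using all finite sets.
\<close>

record (overloaded) ('a, 'b, 'k) linear_hopf_data =
  lbasis :: "'a set \<Rightarrow> 'b set"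
  lrelabel :: "'a set \<Rightarrow> ('a \<Rightarrow> 'a) \<Rightarrow> ('b \<Rightarrow>\<^sub>0 'k) \<Rightarrow> ('b \<Rightarrow>\<^sub>0 'k)"
  lmult :: "'a set \<Rightarrow> 'a set \<Rightarrow> (('b \<times> 'b) \<Rightarrow>\<^sub>0 'k) \<Rightarrow> ('b \<Rightarrow>\<^sub>0 'k)"
  lcomult :: "'a set \<Rightarrow> 'a set \<Rightarrow> ('b \<Rightarrow>\<^sub>0 'k) \<Rightarrow> (('b \<times> 'b) \<Rightarrow>\<^sub>0 'k)"
  lunit :: "'b \<Rightarrow>\<^sub>0 'k"
  lcounit :: "('b \<Rightarrow>\<^sub>0 'k) \<Rightarrow> 'k"

locale linear_species =
  fixes L :: "('a, 'b, 'k::field) linear_hopf_data"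
  assumes lrelabel_linear:
      "\<And>M N \<sigma>. finite M \<Longrightarrow> bij_betw \<sigma> M N \<Longrightarrow>
        linear_map (lbasis L M) (lbasis L N) (lrelabel L M \<sigma>)"
    and lrelabel_cong:
      "\<And>M N \<sigma> \<tau> v. finite M \<Longrightarrow> bij_betw \<sigma> M N \<Longrightarrow> (\<And>a. a \<in> M \<Longrightarrow> \<sigma> a = \<tau> a) \<Longrightarrow>
        v \<in> free_space (lbasis L M) \<Longrightarrow> lrelabel L M \<sigma> v = lrelabel L M \<tau> v"
    and lrelabel_id:
      "\<And>M v. finite M \<Longrightarrow> v \<in> free_space (lbasis L M) \<Longrightarrow> lrelabel L M id v = v"
    and lrelabel_comp:
      "\<And>M N P \<sigma> \<tau> v. finite M \<Longrightarrow> bij_betw \<sigma> M N \<Longrightarrow> bij_betw \<tau> N P \<Longrightarrow>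
        v \<in> free_space (lbasis L M) \<Longrightarrow>
        lrelabel L M (\<tau> \<circ> \<sigma>) v = lrelabel L N \<tau> (lrelabel L M \<sigma> v)"

locale linear_bimonoid = linear_species L
  for L :: "('a, 'b, 'k::field) linear_hopf_data" +
  assumes lmult_linear:
      "\<And>M N. finite M \<Longrightarrow> finite N \<Longrightarrow> M \<inter> N = {} \<Longrightarrow>
        linear_map (lbasis L M \<times> lbasis L N) (lbasis L (M \<union> N)) (lmult L M N)"
    and lcomult_linear:
      "\<And>M N. finite M \<Longrightarrow> finite N \<Longrightarrow> M \<inter> N = {} \<Longrightarrow>
        linear_map (lbasis L (M \<union> N)) (lbasis L M \<times> lbasis L N) (lcomult L M N)"
    and lunit_closed: "lunit L \<in> free_space (lbasis L {})"
    and lcounit_linear: "linear_form (lbasis L {}) (lcounit L)"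
    and lmult_natural:
      "\<And>M N P \<sigma> v. finite M \<Longrightarrow> finite N \<Longrightarrow> M \<inter> N = {} \<Longrightarrow> bij_betw \<sigma> (M \<union> N) P \<Longrightarrow>
        v \<in> free_space (lbasis L M \<times> lbasis L N) \<Longrightarrow>
        lrelabel L (M \<union> N) \<sigma> (lmult L M N v) =
        lmult L (\<sigma> ` M) (\<sigma> ` N) (tensor_map (lrelabel L M \<sigma>) (lrelabel L N \<sigma>) v)"
    and lcomult_natural:
      "\<And>M N P \<sigma> v. finite M \<Longrightarrow> finite N \<Longrightarrow> M \<inter> N = {} \<Longrightarrow> bij_betw \<sigma> (M \<union> N) P \<Longrightarrow>
        v \<in> free_space (lbasis L (M \<union> N)) \<Longrightarrow>
        lcomult L (\<sigma> ` M) (\<sigma> ` N) (lrelabel L (M \<union> N) \<sigma> v) =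
        tensor_map (lrelabel L M \<sigma>) (lrelabel L N \<sigma>) (lcomult L M N v)"
    and lmult_assoc:
      "\<And>M N P v. finite M \<Longrightarrow> finite N \<Longrightarrow> finite P \<Longrightarrow>
        M \<inter> N = {} \<Longrightarrow> M \<inter> P = {} \<Longrightarrow> N \<inter> P = {} \<Longrightarrow>
        v \<in> free_space ((lbasis L M \<times> lbasis L N) \<times> lbasis L P) \<Longrightarrow>
        lmult L (M \<union> N) P (tensor_map (lmult L M N) id v) =
        lmult L M (N \<union> P) (tensor_map id (lmult L N P) (tensor_assoc v))"
    and lcomult_coassoc:
      "\<And>M N P v. finite M \<Longrightarrow> finite N \<Longrightarrow> finite P \<Longrightarrow>
        M \<inter> N = {} \<Longrightarrow> M \<inter> P = {} \<Longrightarrow> N \<inter> P = {} \<Longrightarrow>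
        v \<in> free_space (lbasis L (M \<union> N \<union> P)) \<Longrightarrow>
        tensor_assoc (tensor_map (lcomult L M N) id (lcomult L (M \<union> N) P v)) =
        tensor_map id (lcomult L N P) (lcomult L M (N \<union> P) v)"
    and lmult_unit:
      "\<And>N v. finite N \<Longrightarrow> v \<in> free_space (lbasis L N) \<Longrightarrow>
        lmult L {} N (tensor (lunit L) v) = v \<and> lmult L N {} (tensor v (lunit L)) = v"
    and lcomult_counit:
      "\<And>N v. finite N \<Longrightarrow> v \<in> free_space (lbasis L N) \<Longrightarrow>
        contract_left (lcounit L) (lcomult L {} N v) = v \<and>
        contract_right (lcounit L) (lcomult L N {} v) = v"
    and lcomult_lmult:
      "\<And>S T S' T' v. finite (S \<union> T) \<Longrightarrow> S \<inter> T = {} \<Longrightarrow> S' \<inter> T' = {} \<Longrightarrow> S \<union> T = S' \<union> T' \<Longrightarrow>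
        v \<in> free_space (lbasis L S \<times> lbasis L T) \<Longrightarrow>
        lcomult L S' T' (lmult L S T v) =
        tensor_map (lmult L (S \<inter> S') (T \<inter> S')) (lmult L (S \<inter> T') (T \<inter> T'))
          (tensor_middle_swap
            (tensor_map (lcomult L (S \<inter> S') (S \<inter> T')) (lcomult L (T \<inter> S') (T \<inter> T')) v))"
    and lcounit_lmult:
      "\<And>u v. u \<in> free_space (lbasis L {}) \<Longrightarrow> v \<in> free_space (lbasis L {}) \<Longrightarrow>
        lcounit L (lmult L {} {} (tensor u v)) = lcounit L u * lcounit L v"
    and lcomult_lunit: "lcomult L {} {} (lunit L) = tensor (lunit L) (lunit L)"
    and lcounit_lunit: "lcounit L (lunit L) = 1"

definition is_antipode ::
  "('a, 'b, 'k::field) linear_hopf_data \<Rightarrow> ('a set \<Rightarrow> ('b \<Rightarrow>\<^sub>0 'k) \<Rightarrow> ('b \<Rightarrow>\<^sub>0 'k)) \<Rightarrow> bool" where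
  "is_antipode L s \<longleftrightarrow>
     (\<forall>N. finite N \<longrightarrow> linear_map (lbasis L N) (lbasis L N) (s N)) \<and>
     (\<forall>M N \<sigma>. finite M \<and> bij_betw \<sigma> M N \<longrightarrow>
        (\<forall>v\<in>free_space (lbasis L M). s N (lrelabel L M \<sigma> v) = lrelabel L M \<sigma> (s M v))) \<and>
     (\<forall>N. finite N \<longrightarrow> (\<forall>v\<in>free_space (lbasis L N).
        (\<Sum>S\<in>Pow N. lmult L S (N - S) (tensor_map (s S) id (lcomult L S (N - S) v))) =
          (if N = {} then smul (lcounit L v) (lunit L) else 0) \<and>
        (\<Sum>S\<in>Pow N. lmult L S (N - S) (tensor_map id (s (N - S)) (lcomult L S (N - S) v))) =
          (if N = {} then smul (lcounit L v) (lunit L) else 0)))"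

text \<open>Connectedness: the space at the empty set is one-dimensional.\<close>

locale connected_linear_hopf_monoid = linear_bimonoid L
  for L :: "('a, 'b, 'k::field) linear_hopf_data" +
  assumes ex_antipode: "\<exists>s. is_antipode L s"
    and connected: "card (lbasis L {}) = 1"


section \<open>Linearized combinatorial Hopf monoids\<close>

text \<open>The value \<open>None\<close> of the coproduct stands for \<open>0\<close>.\<close>

record ('a, 'h) set_hopf_data =
  structs :: "'a set \<Rightarrow> 'h set"
  relabel :: "'a set \<Rightarrow> ('a \<Rightarrow> 'a) \<Rightarrow> 'h \<Rightarrow> 'h"
  hmult :: "'a set \<Rightarrow> 'a set \<Rightarrow> 'h \<Rightarrow> 'h \<Rightarrow> 'h"
  hcomult :: "'a set \<Rightarrow> 'a set \<Rightarrow> 'h \<Rightarrow> ('h \<times> 'h) option"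

locale set_species =
  fixes H :: "('a, 'h) set_hopf_data"
  assumes structs_finite: "\<And>N. finite N \<Longrightarrow> finite (structs H N)"
    and relabel_bij:
      "\<And>M N \<sigma>. finite M \<Longrightarrow> bij_betw \<sigma> M N \<Longrightarrow>
        bij_betw (relabel H M \<sigma>) (structs H M) (structs H N)"
    and relabel_cong:
      "\<And>M N \<sigma> \<tau> x. finite M \<Longrightarrow> bij_betw \<sigma> M N \<Longrightarrow> (\<And>a. a \<in> M \<Longrightarrow> \<sigma> a = \<tau> a) \<Longrightarrow>
        x \<in> structs H M \<Longrightarrow> relabel H M \<sigma> x = relabel H M \<tau> x"
    and relabel_id: "\<And>M x. finite M \<Longrightarrow> x \<in> structs H M \<Longrightarrow> relabel H M id x = x"
    and relabel_comp:
      "\<And>M N P \<sigma> \<tau> x. finite M \<Longrightarrow> bij_betw \<sigma> M N \<Longrightarrow> bij_betw \<tau> N P \<Longrightarrow> x \<in> structs H M \<Longrightarrow>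
        relabel H M (\<tau> \<circ> \<sigma>) x = relabel H N \<tau> (relabel H M \<sigma> x)"

definition linearization ::
  "('a, 'h) set_hopf_data \<Rightarrow> ('h \<Rightarrow>\<^sub>0 'k::field) \<Rightarrow> (('h \<Rightarrow>\<^sub>0 'k) \<Rightarrow> 'k) \<Rightarrow>
   ('a, 'h, 'k) linear_hopf_data" where
  "linearization H u e =
     \<lparr> lbasis = structs H,
       lrelabel = (\<lambda>M \<sigma>. lin_ext (\<lambda>x. basis_vec (relabel H M \<sigma> x))),
       lmult = (\<lambda>M N. lin_ext (\<lambda>(x, y). basis_vec (hmult H M N x y))),
       lcomult = (\<lambda>M N. lin_ext (\<lambda>h. case hcomult H M N h of None \<Rightarrow> 0 | Some p \<Rightarrow> basis_vec p)),
       lunit = u,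
       lcounit = e \<rparr>"

text \<open>The argument \<open>K\<close> only fixes the ground field \<open>'k\<close> of the linearization.\<close>

locale linearized_hopf_monoid = set_species H
  for K :: "'k::field itself" and H :: "('a, 'h) set_hopf_data" +
  assumes card_structs_empty: "card (structs H {}) = 1"
    and hmult_closed:
      "\<And>M N x y. finite M \<Longrightarrow> finite N \<Longrightarrow> M \<inter> N = {} \<Longrightarrow>
        x \<in> structs H M \<Longrightarrow> y \<in> structs H N \<Longrightarrow> hmult H M N x y \<in> structs H (M \<union> N)"
    and hcomult_closed:
      "\<And>M N h x y. finite M \<Longrightarrow> finite N \<Longrightarrow> M \<inter> N = {} \<Longrightarrow>
        h \<in> structs H (M \<union> N) \<Longrightarrow> hcomult H M N h = Some (x, y) \<Longrightarrow>
        x \<in> structs H M \<and> y \<in> structs H N"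
    and linearization_hopf:
      "\<exists>(u :: 'h \<Rightarrow>\<^sub>0 'k) e. connected_linear_hopf_monoid (linearization H u e)"

locale linearized_combinatorial_hopf_monoid = linearized_hopf_monoid K H
  for K :: "'k::field itself" and H :: "('a, 'h) set_hopf_data" +
  fixes \<phi> :: "'a set \<Rightarrow> 'h \<Rightarrow> nat"
  assumes character_values: "\<And>N x. finite N \<Longrightarrow> x \<in> structs H N \<Longrightarrow> \<phi> N x \<in> {0, 1}"
    and character_natural:
      "\<And>M N \<sigma> x. finite M \<Longrightarrow> bij_betw \<sigma> M N \<Longrightarrow> x \<in> structs H M \<Longrightarrow>
        \<phi> N (relabel H M \<sigma> x) = \<phi> M x"
    and character_mult:
      "\<And>M N x y. finite M \<Longrightarrow> finite N \<Longrightarrow> M \<inter> N = {} \<Longrightarrow>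
        x \<in> structs H M \<Longrightarrow> y \<in> structs H N \<Longrightarrow>
        \<phi> (M \<union> N) (hmult H M N x y) = \<phi> M x * \<phi> N y"


section \<open>Proper set compositions and proper colorings\<close>

definition set_compositions :: "'a set \<Rightarrow> 'a set list set" where
  "set_compositions N = {C. distinct C \<and> partition_on N (set C)}"

definition compositions :: "nat \<Rightarrow> nat list set" where
  "compositions n = {\<alpha>. (\<forall>a\<in>set \<alpha>. 0 < a) \<and> sum_list \<alpha> = n}"

definition comp_type :: "'a set list \<Rightarrow> nat list" where
  "comp_type C = map card C"

text \<open>The empty composition (of the empty set) yields the empty tuple.\<close>

fun comult_comp ::
  "('a, 'h) set_hopf_data \<Rightarrow> 'a set \<Rightarrow> 'a set list \<Rightarrow> 'h \<Rightarrow> 'h list option" where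
  "comult_comp H N [] h = Some []"
| "comult_comp H N [B] h = Some [h]"
| "comult_comp H N (B # B' # C) h =
     (case hcomult H B (N - B) h of
        None \<Rightarrow> None
      | Some (x, y) \<Rightarrow> map_option ((#) x) (comult_comp H (N - B) (B' # C) y))"

definition char_comp ::
  "('a, 'h) set_hopf_data \<Rightarrow> ('a set \<Rightarrow> 'h \<Rightarrow> nat) \<Rightarrow> 'a set \<Rightarrow> 'a set list \<Rightarrow> 'h \<Rightarrow> nat" where
  "char_comp H \<phi> N C h =
     (case comult_comp H N C h of
        None \<Rightarrow> 0
      | Some hs \<Rightarrow> (\<Prod>i<length C. \<phi> (C ! i) (hs ! i)))"

definition proper_comps ::
  "('a, 'h) set_hopf_data \<Rightarrow> ('a set \<Rightarrow> 'h \<Rightarrow> nat) \<Rightarrow> 'a set \<Rightarrow> 'h \<Rightarrow> 'a set list set" where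
  "proper_comps H \<phi> N h = {C \<in> set_compositions N. char_comp H \<phi> N C h = 1}"

definition proper_comps_of_type ::
  "('a, 'h) set_hopf_data \<Rightarrow> ('a set \<Rightarrow> 'h \<Rightarrow> nat) \<Rightarrow> 'a set \<Rightarrow> 'h \<Rightarrow> nat list \<Rightarrow> 'a set list set" where
  "proper_comps_of_type H \<phi> N h \<alpha> = {C \<in> proper_comps H \<phi> N h. comp_type C = \<alpha>}"

definition coloring_comp :: "'a set \<Rightarrow> ('a \<Rightarrow> nat) \<Rightarrow> 'a set list" where
  "coloring_comp N f = map (\<lambda>i. {v \<in> N. f v = i}) (sorted_list_of_set (f ` N))"

definition proper_colorings ::
  "('a, 'h) set_hopf_data \<Rightarrow> ('a set \<Rightarrow> 'h \<Rightarrow> nat) \<Rightarrow> 'a set \<Rightarrow> 'h \<Rightarrow> ('a \<Rightarrow> nat) set" where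
  "proper_colorings H \<phi> N h = {f \<in> N \<rightarrow>\<^sub>E UNIV. char_comp H \<phi> N (coloring_comp N f) h = 1}"


section \<open>Group actions\<close>

definition perm_group :: "'a set \<Rightarrow> ('a \<Rightarrow> 'a) monoid" where
  "perm_group N = \<lparr> carrier = {g. g permutes N}, monoid.mult = (\<circ>), one = id \<rparr>"

definition aut :: "('a, 'h) set_hopf_data \<Rightarrow> 'a set \<Rightarrow> 'h \<Rightarrow> ('a \<Rightarrow> 'a) set" where
  "aut H N h = stabilizer (perm_group N) (\<lambda>g. relabel H N g) h"

definition act_coloring :: "('a \<Rightarrow> 'a) \<Rightarrow> ('a \<Rightarrow> nat) \<Rightarrow> 'a \<Rightarrow> nat" where
  "act_coloring g f = f \<circ> inv_into UNIV g"

definition act_comp :: "('a \<Rightarrow> 'a) \<Rightarrow> 'a set list \<Rightarrow> 'a set list" where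
  "act_comp g C = map ((`) g) C"


section \<open>Formal power series and the chromatic invariants\<close>

text \<open>
  A formal power series in the indeterminates \<open>x\<^sub>i\<close>, \<open>i \<in> \<nat>\<close>, is its function of coefficients; the
  finitely supported exponent vector \<open>m\<close> stands for the monomial with exponent \<open>m i\<close> at \<open>x\<^sub>i\<close>.
  Addition is pointwise. Since colors range over all natural numbers, there is an
  indeterminate \<open>x\<^sub>0\<close>.
\<close>

type_synonym series = "(nat \<Rightarrow>\<^sub>0 nat) \<Rightarrow> complex"

text \<open>
  \<open>monomial_sum S w\<close> is the possibly infinite formal sum of the monomials \<open>w s\<close> over \<open>s \<in> S\<close>. It
  is meaningful when every fibre of \<open>w\<close> is finite; the two lemmas below check this for its uses.
\<close>

definition monomial_sum :: "'s set \<Rightarrow> ('s \<Rightarrow> nat \<Rightarrow>\<^sub>0 nat) \<Rightarrow> series" where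
  "monomial_sum S w = (\<lambda>m. of_nat (card {s \<in> S. w s = m}))"

definition scale_series :: "complex \<Rightarrow> series \<Rightarrow> series" where
  "scale_series c F = (\<lambda>m. c * F m)"

definition coloring_monomial :: "'a set \<Rightarrow> ('a \<Rightarrow> nat) \<Rightarrow> nat \<Rightarrow>\<^sub>0 nat" where
  "coloring_monomial N f = (\<Sum>v\<in>N. Poly_Mapping.single (f v) 1)"

definition monomial_qsym :: "nat list \<Rightarrow> series" where
  "monomial_qsym \<alpha> =
     monomial_sum {js. length js = length \<alpha> \<and> sorted_wrt (<) js}
       (\<lambda>js. \<Sum>j<length \<alpha>. Poly_Mapping.single (js ! j) (\<alpha> ! j))"

definition chrom_qsym ::
  "('a, 'h) set_hopf_data \<Rightarrow> ('a set \<Rightarrow> 'h \<Rightarrow> nat) \<Rightarrow> 'a set \<Rightarrow> 'h \<Rightarrow> ('a \<Rightarrow> 'a) \<Rightarrow> series" where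
  "chrom_qsym H \<phi> N h g =
     monomial_sum {f \<in> proper_colorings H \<phi> N h. act_coloring g f = f} (coloring_monomial N)"

definition chrom_poly ::
  "('a, 'h) set_hopf_data \<Rightarrow> ('a set \<Rightarrow> 'h \<Rightarrow> nat) \<Rightarrow> 'a set \<Rightarrow> 'h \<Rightarrow> nat \<Rightarrow> ('a \<Rightarrow> 'a) \<Rightarrow> complex" where
  "chrom_poly H \<phi> N h x g =
     of_nat (card {f \<in> proper_colorings H \<phi> N h. act_coloring g f = f \<and> f ` N \<subseteq> {1..x}})"

definition comp_character ::
  "('a, 'h) set_hopf_data \<Rightarrow> ('a set \<Rightarrow> 'h \<Rightarrow> nat) \<Rightarrow> 'a set \<Rightarrow> 'h \<Rightarrow> nat list \<Rightarrow> ('a \<Rightarrow> 'a) \<Rightarrow> complex" where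
  "comp_character H \<phi> N h \<alpha> g =
     of_nat (card {C \<in> proper_comps_of_type H \<phi> N h \<alpha>. act_comp g C = C})"

lemma keys_sum_nat:
  fixes p :: "'s \<Rightarrow> nat \<Rightarrow>\<^sub>0 nat"
  assumes "finite I"
  shows "Poly_Mapping.keys (\<Sum>i\<in>I. p i) = (\<Union>i\<in>I. Poly_Mapping.keys (p i))"
  using assms by (auto simp: Poly_Mapping.in_keys_iff Poly_Mapping.lookup_sum)

lemma finite_coloring_monomial_fibre:
  assumes "finite N"
  shows "finite {f \<in> N \<rightarrow>\<^sub>E UNIV. coloring_monomial N f = m}"
proof (rule finite_subset)
  show "{f \<in> N \<rightarrow>\<^sub>E UNIV. coloring_monomial N f = m} \<subseteq> (N \<rightarrow>\<^sub>E Poly_Mapping.keys m)"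
    using assms by (auto simp: coloring_monomial_def keys_sum_nat PiE_def Pi_def)
  show "finite (N \<rightarrow>\<^sub>E Poly_Mapping.keys m)"
    using assms by (intro finite_PiE) auto
qed

lemma finite_monomial_qsym_fibre:
  fixes m :: "nat \<Rightarrow>\<^sub>0 nat"
  assumes "\<alpha> \<in> compositions n"
  shows "finite {js. (length js = length \<alpha> \<and> sorted_wrt (<) js) \<and>
    (\<Sum>j<length \<alpha>. Poly_Mapping.single (js ! j) (\<alpha> ! j)) = m}" (is "finite ?A")
proof (rule finite_subset)
  have pos: "\<alpha> ! j \<noteq> 0" if "j < length \<alpha>" for j
    using assms that by (auto simp: compositions_def dest: nth_mem)
  show "?A \<subseteq> {js. set js \<subseteq> Poly_Mapping.keys m \<and> length js = length \<alpha>}"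
    using pos by (fastforce simp: keys_sum_nat in_set_conv_nth)
  show "finite {js. set js \<subseteq> Poly_Mapping.keys m \<and> length js = length \<alpha>}"
    by (rule finite_lists_length_eq) auto
qed

lemma finite_set_compositions:
  assumes "finite N"
  shows "finite (set_compositions N)"
proof (rule finite_subset)
  show "set_compositions N \<subseteq> {C. set C \<subseteq> Pow N \<and> distinct C}"
    by (auto simp: set_compositions_def partition_on_def)
  show "finite {C. set C \<subseteq> Pow N \<and> distinct C}"
    using assms finite_subset_distinct[of "Pow N"] by (simp add: conj_commute)
qed

lemma finite_compositions: "finite (compositions n)"
proof (rule finite_subset)
  have "length \<alpha> \<le> sum_list \<alpha>" if "\<forall>a\<in>set \<alpha>. 0 < a" for \<alpha> :: "nat list"
    using that by (induction \<alpha>) auto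
  then show "compositions n \<subseteq> {\<alpha>. set \<alpha> \<subseteq> {..n} \<and> length \<alpha> \<le> n}"
    by (auto simp: compositions_def dest: member_le_sum_list)
  show "finite {\<alpha>. set \<alpha> \<subseteq> {..n} \<and> length \<alpha> \<le> n}"
    by (rule finite_lists_length_le) simp
qed

end

theory Submission
  imports Defs
begin

text \<open>
  A coloring is the same thing as its set composition together with the increasing list of its
  colors, and it is fixed by a permutation exactly if its set composition is. All three identities
  count the fixed proper colorings by their set composition \<open>C\<close>: the colorings with set
  composition \<open>C\<close> contribute \<open>M\<^bsub>\<alpha>(C)\<^esub>\<close> to the series, and those with colors in \<open>[x]\<close>
  correspond to the subsets of \<open>[x]\<close> of size \<open>\<ell>(C)\<close>.
\<close>

abbreviation increasing_lists :: "nat \<Rightarrow> nat list set" where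
  "increasing_lists k \<equiv> {js. length js = k \<and> sorted_wrt (<) js}"

section \<open>Set compositions and their types\<close>

lemma set_compositions_disjoint:
  assumes "C \<in> set_compositions N" "i < length C" "j < length C" "v \<in> C ! i" "v \<in> C ! j"
  shows "i = j"
proof -
  have C: "distinct C" "disjoint (set C)"
    using assms(1) by (auto simp: set_compositions_def partition_on_def)
  have "C ! i = C ! j"
    using disjointD[OF C(2), of "C ! i" "C ! j"] assms(2-) by auto
  then show ?thesis
    using C(1) assms(2,3) by (simp add: nth_eq_iff_index_eq)
qed

lemma set_compositions_cover:
  assumes "C \<in> set_compositions N"
  shows "(\<Union>i<length C. C ! i) = N"
proof -
  have "\<Union> (set C) = N"
    using assms by (auto simp: set_compositions_def partition_on_def)
  then show ?thesis by (auto simp: set_conv_nth)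
qed

lemma set_compositions_nonempty:
  assumes "C \<in> set_compositions N" "i < length C"
  shows "C ! i \<noteq> {}"
  using assms by (metis (mono_tags, lifting) mem_Collect_eq nth_mem partition_onD3
      set_compositions_def)

lemma coloring_comp_in_set_compositions:
  assumes "finite N"
  shows "coloring_comp N f \<in> set_compositions N"
proof -
  have "inj_on (\<lambda>i. {v \<in> N. f v = i}) (f ` N)"
    by (auto intro!: inj_onI)
  moreover have "partition_on N ((\<lambda>i. {v \<in> N. f v = i}) ` f ` N)"
    by (auto simp: partition_on_def disjoint_def)
  ultimately show ?thesis
    using assms by (simp add: set_compositions_def coloring_comp_def distinct_map)
qed

lemma comp_type_in_compositions:
  assumes "finite N" "C \<in> set_compositions N"
  shows "comp_type C \<in> compositions (card N)"
proof -
  have C: "distinct C" "partition_on N (set C)"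
    using assms by (auto simp: set_compositions_def)
  have fin: "finite B" if "B \<in> set C" for B
    using that C assms(1) by (metis Union_upper finite_subset partition_onD1)
  have "sum_list (map card C) = (\<Sum>B\<in>set C. card B)"
    using C(1) by (simp add: sum_list_distinct_conv_sum_set)
  also have "\<dots> = card (\<Union> (set C))"
    using C fin by (intro card_Union_disjoint[symmetric])
      (auto simp: partition_on_def disjoint_def pairwise_def disjnt_def)
  also have "\<dots> = card N"
    using C(2) by (simp add: partition_on_def)
  finally show ?thesis
    using C(2) fin by (auto simp: compositions_def comp_type_def partition_on_def card_gt_0_iff)
qed

section \<open>Colorings as pairs of a set composition and a list of colors\<close>

text \<open>The criterion behind the correspondence: \<open>js\<close> serves as the list of colors
  exactly when \<open>f\<close> takes its \<open>i\<close>-th entry throughout the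
  \<open>i\<close>-th block. Conversely, nonempty blocks ensure that every entry of
  \<open>js\<close> is used, and distinct entries keep different blocks from merging.\<close>

lemma coloring_comp_eq_iff:
  assumes N: "finite N" and C: "C \<in> set_compositions N" and js: "js \<in> increasing_lists (length C)"
  shows "coloring_comp N f = C \<and> sorted_list_of_set (f ` N) = js \<longleftrightarrow>
    (\<forall>i<length C. \<forall>v\<in>C ! i. f v = js ! i)" (is "?L \<longleftrightarrow> ?R")
proof
  assume ?L
  then have "C ! i = {v \<in> N. f v = js ! i}" if "i < length C" for i
    using that by (auto simp: coloring_comp_def)
  then show ?R by auto
next
  assume R: ?R
  have len: "length js = length C" and sorted: "sorted_wrt (<) js" using js by auto
  have "f ` N = (\<Union>i<length C. f ` (C ! i))"
    using set_compositions_cover[OF C] by (metis image_UN)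
  also have "\<dots> = (\<Union>i<length C. {js ! i})"
    \<comment> \<open>An empty block would lose its color from the image; nonemptiness makes each
      image a singleton.\<close>
    using R set_compositions_nonempty[OF C] by (intro SUP_cong) (auto simp: image_constant_conv)
  also have "\<dots> = set js"
    using len by (auto simp: set_conv_nth)
  finally have srt: "sorted_list_of_set (f ` N) = js"
    using sorted by (simp add: strict_sorted_iff sorted_list_of_set.idem_if_sorted_distinct)
  have "{v \<in> N. f v = js ! i} = C ! i" if i: "i < length C" for i
  proof
    show "C ! i \<subseteq> {v \<in> N. f v = js ! i}"
      using R i set_compositions_cover[OF C] by auto
    show "{v \<in> N. f v = js ! i} \<subseteq> C ! i"
    proof
      fix v assume v: "v \<in> {v \<in> N. f v = js ! i}"
      then obtain j where j: "j < length C" "v \<in> C ! j"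
        using set_compositions_cover[OF C] by blast
      with R v have "js ! j = js ! i" by auto
      \<comment> \<open>A strictly increasing list has no repeated entries, so equal colors sit at
        equal positions.\<close>
      then have "j = i"
        using sorted len i j by (simp add: strict_sorted_iff nth_eq_iff_index_eq)
      with j show "v \<in> C ! i" by simp
    qed
  qed
  then have "coloring_comp N f = C"
    using len srt by (intro nth_equalityI) (auto simp: coloring_comp_def)
  with srt show ?L by simp
qed

lemma bij_betw_colors:
  assumes N: "finite N" and C: "C \<in> set_compositions N"
  shows "bij_betw (\<lambda>f. sorted_list_of_set (f ` N))
    {f \<in> N \<rightarrow>\<^sub>E UNIV. coloring_comp N f = C} (increasing_lists (length C))"
    (is "bij_betw ?c ?F ?J")
proof (rule bij_betw_imageI)
  \<comment> \<open>\<open>C\<close> is here a map over the list of colors, so the two lengths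
    agree.\<close>
  have closed: "?c f \<in> ?J" if "f \<in> ?F" for f
    using that by (auto simp: coloring_comp_def)
  have val: "f v = ?c f ! i" if "f \<in> ?F" "i < length C" "v \<in> C ! i" for f i v
  proof -
    have "coloring_comp N f = C" using that(1) by simp
    with coloring_comp_eq_iff[OF N C closed[OF that(1)], of f] that(2,3) show ?thesis by blast
  qed
  show "inj_on ?c ?F"
  proof (rule inj_onI)
    fix f f' assume f: "f \<in> ?F" and f': "f' \<in> ?F" and eq: "?c f = ?c f'"
    \<comment> \<open>\<open>val\<close> determines the values on \<open>N\<close>; off
      \<open>N\<close> both colorings are \<open>undefined\<close>.\<close>
    show "f = f'"
    proof (rule extensionalityI[of _ N])
      show "f \<in> extensional N" "f' \<in> extensional N"
        using f f' by (auto simp: PiE_def)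
      fix v assume "v \<in> N"
      then obtain i where "i < length C" "v \<in> C ! i"
        using set_compositions_cover[OF C] by blast
      then show "f v = f' v" using val[OF f] val[OF f'] eq by simp
    qed
  qed
  have "js \<in> ?c ` ?F" if js: "js \<in> ?J" for js
  proof -
    have "\<forall>v\<in>N. \<exists>i. i < length C \<and> v \<in> C ! i"
      using set_compositions_cover[OF C] by blast
    \<comment> \<open>\<open>idx v\<close> is the position of the block containing \<open>v\<close>.
      Coloring each \<open>v\<close> by the entry of \<open>js\<close> at that position gives the
      preimage; disjoint blocks make the position unique.\<close>
    then obtain idx where idx: "\<And>v. v \<in> N \<Longrightarrow> idx v < length C \<and> v \<in> C ! idx v"
      by metis
    define f where "f = restrict (\<lambda>v. js ! idx v) N"
    have "f v = js ! i" if "i < length C" "v \<in> C ! i" for i v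
    proof -
      have "v \<in> N" using that set_compositions_cover[OF C] by blast
      moreover from this have "idx v = i"
        using idx that set_compositions_disjoint[OF C] by blast
      ultimately show ?thesis by (simp add: f_def)
    qed
    then have "coloring_comp N f = C \<and> ?c f = js"
      using coloring_comp_eq_iff[OF N C js, of f] by blast
    moreover have "f \<in> N \<rightarrow>\<^sub>E UNIV" by (simp add: f_def)
    ultimately show ?thesis by blast
  qed
  then show "?c ` ?F = ?J"
    using closed by (intro subset_antisym image_subsetI subsetI)
qed

text \<open>Collecting the factors block by block, each block contributes a power of its color's
  indeterminate with the block size as exponent. This is the term of the monomial quasisymmetric
  function indexed by the list of colors.\<close>

lemma coloring_monomial_eq:
  assumes N: "finite N" and C: "coloring_comp N f = C"
  shows "coloring_monomial N f = (\<Sum>j<length (comp_type C).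
    Poly_Mapping.single (sorted_list_of_set (f ` N) ! j) (comp_type C ! j))"
proof -
  let ?js = "sorted_list_of_set (f ` N)"
  have sc: "C \<in> set_compositions N"
    using coloring_comp_in_set_compositions[OF N] C by blast
  have js: "?js \<in> increasing_lists (length C)"
    using C by (auto simp: coloring_comp_def)
  have val: "f v = ?js ! i" if "i < length C" "v \<in> C ! i" for i v
    using coloring_comp_eq_iff[OF N sc js, of f] C that by blast
  have fin: "finite (C ! i)" if "i < length C" for i
    using that N set_compositions_cover[OF sc] by (metis UN_upper finite_subset lessThan_iff)
  \<comment> \<open>Adding exponent vectors multiplies monomials, so this sum is a power of a single
    indeterminate.\<close>
  have const: "(\<Sum>v\<in>B. Poly_Mapping.single k (1::nat)) = Poly_Mapping.single k (card B)"
    if "finite B" for k :: nat and B :: "'a set"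
    using that by (induction rule: finite_induct) (simp_all add: single_add[symmetric] del: sum_constant)
  have "coloring_monomial N f = (\<Sum>v\<in>(\<Union>i<length C. C ! i). Poly_Mapping.single (f v) 1)"
    by (simp add: coloring_monomial_def set_compositions_cover[OF sc])
  also have "\<dots> = (\<Sum>i<length C. \<Sum>v\<in>C ! i. Poly_Mapping.single (f v) 1)"
    using fin set_compositions_disjoint[OF sc] by (intro sum.UNION_disjoint) auto
  also have "\<dots> = (\<Sum>i<length C. \<Sum>v\<in>C ! i. Poly_Mapping.single (?js ! i) 1)"
    by (intro sum.cong refl) (simp add: val)
  also have "\<dots> = (\<Sum>i<length C. Poly_Mapping.single (?js ! i) (card (C ! i)))"
    by (intro sum.cong refl const fin) simp
  finally show ?thesis by (simp add: comp_type_def)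
qed

section \<open>Counting colorings by their set composition\<close>

text \<open>There may be infinitely many colorings, and \<open>card\<close> is 0 on infinite sets.
  \<open>P\<close> cuts them down to a finite set: later it fixes the monomial or bounds the
  colors.\<close>

lemma card_colorings_by_comp:
  assumes N: "finite N" and S: "S \<subseteq> set_compositions N"
    and fin: "finite {f \<in> N \<rightarrow>\<^sub>E UNIV. P f}"
  shows "card {f \<in> N \<rightarrow>\<^sub>E UNIV. coloring_comp N f \<in> S \<and> P f} =
    (\<Sum>C\<in>S. card {f \<in> N \<rightarrow>\<^sub>E UNIV. coloring_comp N f = C \<and> P f})"
proof -
  have "{f \<in> N \<rightarrow>\<^sub>E UNIV. coloring_comp N f \<in> S \<and> P f} =
      (\<Union>C\<in>S. {f \<in> N \<rightarrow>\<^sub>E UNIV. coloring_comp N f = C \<and> P f})" by auto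
  moreover have "finite S"
    using S finite_set_compositions[OF N] by (rule finite_subset)
  moreover have "finite {f \<in> N \<rightarrow>\<^sub>E UNIV. coloring_comp N f = C \<and> P f}" for C
    using fin by (rule rev_finite_subset) auto
  ultimately show ?thesis by (simp, intro card_UN_disjoint) auto
qed

text \<open>Restricts \<open>bij_betw_colors\<close> to colorings satisfying a condition that can be
  read off the list of colors.\<close>

lemma card_colorings_eq_card_lists:
  assumes "finite N" and "C \<in> set_compositions N"
    and PQ: "\<And>f. f \<in> N \<rightarrow>\<^sub>E UNIV \<Longrightarrow> coloring_comp N f = C \<Longrightarrow>
      P f \<longleftrightarrow> Q (sorted_list_of_set (f ` N))"
  shows "card {f \<in> N \<rightarrow>\<^sub>E UNIV. coloring_comp N f = C \<and> P f} =
    card {js \<in> increasing_lists (length C). Q js}"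
proof -
  let ?c = "\<lambda>f. sorted_list_of_set (f ` N)"
  let ?F = "{f \<in> N \<rightarrow>\<^sub>E UNIV. coloring_comp N f = C}"
  note bij = bij_betw_colors[OF assms(1,2)]
  have eq: "{f \<in> N \<rightarrow>\<^sub>E UNIV. coloring_comp N f = C \<and> P f} = {f \<in> ?F. Q (?c f)}"
    using PQ by blast
  have "?c ` {f \<in> ?F. Q (?c f)} = {js \<in> ?c ` ?F. Q js}" by blast
  also have "\<dots> = {js \<in> increasing_lists (length C). Q js}"
    unfolding bij_betw_imp_surj_on[OF bij] ..
  finally have "bij_betw ?c {f \<in> ?F. Q (?c f)} {js \<in> increasing_lists (length C). Q js}"
    by (rule bij_betw_subset[OF bij, rotated]) blast
  then show ?thesis
    unfolding eq by (rule bij_betw_same_card)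
qed

lemma monomial_sum_by_comp:
  assumes N: "finite N" and S: "S \<subseteq> set_compositions N"
  shows "monomial_sum {f \<in> N \<rightarrow>\<^sub>E UNIV. coloring_comp N f \<in> S} (coloring_monomial N) =
    (\<Sum>C\<in>S. monomial_qsym (comp_type C))"
proof
  fix m
  \<comment> \<open>Series are compared coefficientwise; their finite sums are taken
    pointwise.\<close>
  have eval: "(\<Sum>C\<in>A. F C) m = (\<Sum>C\<in>A. F C m)" for A and F :: "'a set list \<Rightarrow> series"
    by (induction A rule: infinite_finite_induct) auto
  have "card {f \<in> N \<rightarrow>\<^sub>E UNIV. coloring_comp N f = C \<and> coloring_monomial N f = m} =
      card {js \<in> increasing_lists (length C).
        (\<Sum>j<length (comp_type C). Poly_Mapping.single (js ! j) (comp_type C ! j)) = m}"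
    if "C \<in> S" for C
    using that S by (intro card_colorings_eq_card_lists N) (auto simp: coloring_monomial_eq[OF N])
  then show "monomial_sum {f \<in> N \<rightarrow>\<^sub>E UNIV. coloring_comp N f \<in> S} (coloring_monomial N) m =
      (\<Sum>C\<in>S. monomial_qsym (comp_type C)) m"
    using card_colorings_by_comp[OF N S finite_coloring_monomial_fibre[OF N], of m]
    by (simp add: eval monomial_sum_def monomial_qsym_def comp_type_def conj_assoc)
qed

text \<open>A strictly increasing list is the sorted enumeration of its set of entries, so these
  lists correspond to the \<open>k\<close>-subsets of \<open>{1..x}\<close>.\<close>

lemma card_increasing_lists:
  "card {js \<in> increasing_lists k. set js \<subseteq> {1..x}} = x choose k"
proof -
  have "bij_betw set {js \<in> increasing_lists k. set js \<subseteq> {1..x}} {B. B \<subseteq> {1..x} \<and> card B = k}"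
  proof (rule bij_betw_byWitness[where f' = sorted_list_of_set])
    show "\<forall>js\<in>{js \<in> increasing_lists k. set js \<subseteq> {1..x}}. sorted_list_of_set (set js) = js"
      by (auto simp: strict_sorted_iff sorted_list_of_set.idem_if_sorted_distinct)
    show "\<forall>B\<in>{B. B \<subseteq> {1..x} \<and> card B = k}. set (sorted_list_of_set B) = B"
      by (auto simp: finite_subset[OF _ finite_atLeastAtMost])
    show "set ` {js \<in> increasing_lists k. set js \<subseteq> {1..x}} \<subseteq> {B. B \<subseteq> {1..x} \<and> card B = k}"
      by (auto simp: strict_sorted_iff distinct_card)
    show "sorted_list_of_set ` {B. B \<subseteq> {1..x} \<and> card B = k} \<subseteq>
        {js \<in> increasing_lists k. set js \<subseteq> {1..x}}"
    proof (rule image_subsetI)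
      fix B assume "B \<in> {B. B \<subseteq> {1..x} \<and> card B = k}"
      moreover from this have "finite B" by (auto intro: finite_subset)
      ultimately show "sorted_list_of_set B \<in> {js \<in> increasing_lists k. set js \<subseteq> {1..x}}"
        by simp
    qed
  qed
  from bij_betw_same_card[OF this] show ?thesis
    using n_subsets[of "{1..x}" k] by simp
qed

lemma card_bounded_colorings_by_comp:
  assumes N: "finite N" and S: "S \<subseteq> set_compositions N"
  shows "card {f \<in> N \<rightarrow>\<^sub>E UNIV. coloring_comp N f \<in> S \<and> f ` N \<subseteq> {1..x}} =
    (\<Sum>C\<in>S. x choose length (comp_type C))"
proof -
  have "{f \<in> N \<rightarrow>\<^sub>E UNIV. f ` N \<subseteq> {1..x}} \<subseteq> (N \<rightarrow>\<^sub>E {1..x})" by auto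
  then have fin: "finite {f \<in> N \<rightarrow>\<^sub>E UNIV. f ` N \<subseteq> {1..x}}"
    by (rule finite_subset) (use N in \<open>auto intro: finite_PiE\<close>)
  have "card {f \<in> N \<rightarrow>\<^sub>E UNIV. coloring_comp N f = C \<and> f ` N \<subseteq> {1..x}} =
      x choose length (comp_type C)" if "C \<in> S" for C
  proof -
    have "card {f \<in> N \<rightarrow>\<^sub>E UNIV. coloring_comp N f = C \<and> f ` N \<subseteq> {1..x}} =
        card {js \<in> increasing_lists (length C). set js \<subseteq> {1..x}}"
      using that S N by (intro card_colorings_eq_card_lists) auto
    then show ?thesis
      unfolding card_increasing_lists by (simp add: comp_type_def)
  qed
  then show ?thesis
    unfolding card_colorings_by_comp[OF N S fin] by (intro sum.cong refl)
qed

section \<open>Colorings fixed by a permutation\<close>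

text \<open>\<open>act_comp\<close> keeps the order of the blocks, so a fixed set composition has
  every block mapped onto itself. As the blocks are the color classes, this says that
  \<open>g\<close> preserves colors.\<close>

lemma act_coloring_fixed_iff:
  assumes g: "g permutes N" and N: "finite N" and f: "f \<in> N \<rightarrow>\<^sub>E UNIV"
  shows "act_coloring g f = f \<longleftrightarrow> act_comp g (coloring_comp N f) = coloring_comp N f"
proof -
  have "act_coloring g f = f \<longleftrightarrow> (\<forall>v. f (g v) = f v)"
    unfolding act_coloring_def fun_eq_iff comp_apply
    \<comment> \<open>Substituting \<open>g v\<close> for \<open>v\<close> removes the inverse;
      next, points off \<open>N\<close> drop out because \<open>g\<close> fixes them.\<close>
    using permutes_inverses[OF g] by metis
  also have "\<dots> \<longleftrightarrow> (\<forall>v\<in>N. f (g v) = f v)"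
    using permutes_not_in[OF g] by metis
  also have "\<dots> \<longleftrightarrow> (\<forall>i\<in>f ` N. g ` {v \<in> N. f v = i} = {v \<in> N. f v = i})"
  proof
    assume L: "\<forall>v\<in>N. f (g v) = f v"
    have "g ` {v \<in> N. f v = i} = {v \<in> N. f v = i}" for i
    \<comment> \<open>\<open>g\<close> maps each color class into itself; injectivity and finiteness
      give equality.\<close>
    proof (rule card_subset_eq)
      show "g ` {v \<in> N. f v = i} \<subseteq> {v \<in> N. f v = i}"
        using L g by (auto simp: permutes_in_image)
      show "card (g ` {v \<in> N. f v = i}) = card {v \<in> N. f v = i}"
        by (intro card_image permutes_inj_on[OF g])
    qed (use N in simp)
    then show "\<forall>i\<in>f ` N. g ` {v \<in> N. f v = i} = {v \<in> N. f v = i}" by blast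
  next
    assume "\<forall>i\<in>f ` N. g ` {v \<in> N. f v = i} = {v \<in> N. f v = i}"
    then show "\<forall>v\<in>N. f (g v) = f v" by blast
  qed
  also have "\<dots> \<longleftrightarrow> act_comp g (coloring_comp N f) = coloring_comp N f"
    using N by (simp add: act_comp_def coloring_comp_def)
  finally show ?thesis .
qed

text \<open>Properness and being fixed by \<open>g\<close> both depend on a coloring only through
  its set composition.\<close>

lemma proper_fixed_colorings_eq:
  assumes "g permutes N" "finite N"
  shows "{f \<in> proper_colorings H \<phi> N h. act_coloring g f = f} =
    {f \<in> N \<rightarrow>\<^sub>E UNIV. coloring_comp N f \<in> {C \<in> proper_comps H \<phi> N h. act_comp g C = C}}"
  using act_coloring_fixed_iff[OF assms] coloring_comp_in_set_compositions[OF assms(2)]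
  by (auto simp: proper_colorings_def proper_comps_def)

section \<open>Grouping by type, and the three identities\<close>

lemma sum_by_comp_type:
  fixes F :: "nat list \<Rightarrow> 'c::comm_monoid_add"
  assumes N: "finite N" and S: "S \<subseteq> set_compositions N"
  shows "(\<Sum>C\<in>S. F (comp_type C)) =
    (\<Sum>\<alpha>\<in>compositions (card N). \<Sum>C\<in>{C \<in> S. comp_type C = \<alpha>}. F \<alpha>)"
proof -
  have "(\<Sum>\<alpha>\<in>compositions (card N). \<Sum>C\<in>{C \<in> S. comp_type C = \<alpha>}. F (comp_type C)) =
      (\<Sum>C\<in>S. F (comp_type C))"
    using S comp_type_in_compositions[OF N] finite_subset[OF S finite_set_compositions[OF N]]
    by (intro sum.group finite_compositions) auto
  moreover have "(\<Sum>C\<in>{C \<in> S. comp_type C = \<alpha>}. F (comp_type C)) =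
      (\<Sum>C\<in>{C \<in> S. comp_type C = \<alpha>}. F \<alpha>)" for \<alpha>
    by (rule sum.cong) auto
  ultimately show ?thesis by simp
qed

text \<open>Turns the number of fixed set compositions of one type into the coefficient of that
  type's monomial quasisymmetric function.\<close>

lemma sum_const_series: "(\<Sum>C\<in>A. F) = scale_series (of_nat (card A)) F"
proof
  fix m
  show "(\<Sum>C\<in>A. F) m = scale_series (of_nat (card A)) F m"
    by (induction A rule: infinite_finite_induct) (auto simp: scale_series_def algebra_simps)
qed

theorem theorem3:
  fixes H :: "('a, 'h) set_hopf_data"
    and \<phi> :: "'a set \<Rightarrow> 'h \<Rightarrow> nat"
    and N :: "'a set" and h :: 'h
    and G :: "('a \<Rightarrow> 'a) set"
  assumes "linearized_combinatorial_hopf_monoid TYPE('k::field) H \<phi>"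
    and "finite N"
    and "h \<in> structs H N"
    and "subgroup G (perm_group N)"
    and "G \<subseteq> aut H N h"
  shows "(\<forall>g\<in>G. chrom_qsym H \<phi> N h g =
            (\<Sum>C\<in>{C \<in> proper_comps H \<phi> N h. act_comp g C = C}. monomial_qsym (comp_type C))) \<and>
         (\<forall>g\<in>G. chrom_qsym H \<phi> N h g =
            (\<Sum>\<alpha>\<in>compositions (card N).
               scale_series (comp_character H \<phi> N h \<alpha> g) (monomial_qsym \<alpha>))) \<and>
         (\<forall>x. \<forall>g\<in>G. chrom_poly H \<phi> N h x g =
            (\<Sum>\<alpha>\<in>compositions (card N).
               comp_character H \<phi> N h \<alpha> g * of_nat (x choose length \<alpha>)))"
proof -
  note N = \<open>finite N\<close>
  \<comment> \<open>\<open>S g\<close> is the index set of the first identity; its part of a given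
    type is what the permutation character counts at \<open>g\<close>.\<close>
  define S where "S g = {C \<in> proper_comps H \<phi> N h. act_comp g C = C}" for g
  have S: "S g \<subseteq> set_compositions N" for g
    by (auto simp: S_def proper_comps_def)
  have char: "comp_character H \<phi> N h \<alpha> g = of_nat (card {C \<in> S g. comp_type C = \<alpha>})" for \<alpha> g
    by (auto simp: comp_character_def S_def proper_comps_of_type_def
        intro!: arg_cong[where f = of_nat] arg_cong[where f = card])
  have perm: "g permutes N" if "g \<in> G" for g
    using that subgroup.subset[OF \<open>subgroup G (perm_group N)\<close>] by (auto simp: perm_group_def)
  have 1: "chrom_qsym H \<phi> N h g = (\<Sum>C\<in>S g. monomial_qsym (comp_type C))" if "g \<in> G" for g
    unfolding chrom_qsym_def proper_fixed_colorings_eq[OF perm[OF that] N] S_def[symmetric]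
    by (rule monomial_sum_by_comp[OF N S])
  have 2: "chrom_qsym H \<phi> N h g = (\<Sum>\<alpha>\<in>compositions (card N).
      scale_series (comp_character H \<phi> N h \<alpha> g) (monomial_qsym \<alpha>))" if "g \<in> G" for g
    unfolding 1[OF that] sum_by_comp_type[OF N S, of monomial_qsym] sum_const_series char ..
  have 3: "chrom_poly H \<phi> N h x g = (\<Sum>\<alpha>\<in>compositions (card N).
      comp_character H \<phi> N h \<alpha> g * of_nat (x choose length \<alpha>))" if "g \<in> G" for x g
  proof -
    have "{f \<in> proper_colorings H \<phi> N h. act_coloring g f = f \<and> f ` N \<subseteq> {1..x}} =
        {f \<in> N \<rightarrow>\<^sub>E UNIV. coloring_comp N f \<in> S g \<and> f ` N \<subseteq> {1..x}}"
      using proper_fixed_colorings_eq[OF perm[OF that] N, of H \<phi> h] by (auto simp: S_def)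
    \<comment> \<open>The count is first made in the natural numbers; grouping by type then replaces
      repeated binomial coefficients by multiples.\<close>
    then have "chrom_poly H \<phi> N h x g = of_nat (\<Sum>C\<in>S g. x choose length (comp_type C))"
      by (simp only: chrom_poly_def card_bounded_colorings_by_comp[OF N S])
    then show ?thesis
      by (simp add: sum_by_comp_type[OF N S, of "\<lambda>\<alpha>. x choose length \<alpha>"] char)
  qed
  from 1 2 3 show ?thesis by (simp add: S_def)
qed

end
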